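(* Let $G=\{(A_1,X_1),\dots,(A_n,X_n)\}$ be a finite set of I/O pairs and $(B,Y)$ a pair. Put $G^\square_{1/2}=\{\square A_i\to X_i\mid (A_i,X_i)\in G\}$ and $G^\square_{3/4}=\{\square A_i\to X_i\wedge\square X_i\mid (A_i,X_i)\in G\}$. Then: (1) $G\vdash_{OUT_1}(B,Y)$ iff $G^\square_{1/2}\models_{\mathbf{K}}\square B\to Y$, and $G\vdash_{OUT_2}(B,Y)$ iff $G^\square_{1/2}\models_{\mathbf{K+F}}\square B\to Y$; (2) $G\vdash_{OUT_3}(B,Y)$ iff $G^\square_{3/4}\models_{\mathbf{K}}\square B\to Y\wedge\square Y$, and $G\vdash_{OUT_4}(B,Y)$ iff $G^\square_{3/4}\models_{\mathbf{K+F}}\square B\to Y\wedge\square Y$; (3) $G\vdash_{OUT_1^+}(B,Y)$ iff $G^\square_{1/2}\models_{\mathbf{KD}}\square B\to Y$, and $G\vdash_{OUT_2^+}(B,Y)$ iff $G^\square_{1/2}\models_{\mathbf{KD+F}}\square B\to Y$; (4) $G\vdash_{OUT_3^+}(B,Y)$ iff $G^\square_{3/4}\models_{\mathbf{KD}}\square B\to Y\wedge\square Y$, and $G\vdash_{OUT_4^+}(B,Y)$ iff $G^\square_{3/4}\models_{\mathbf{KD+F}}\square B\to Y\wedge\square Y$.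
   Context: Formulas $A_i,X_i,B,Y$ are classical propositional formulas built with $\top,\bot,\neg,\wedge,\vee,\to$; $\models$ denotes classical semantic entailment. An I/O pair is an ordered pair $(A,X)$ of formulas. Rules on pairs: (TOP) $(\top,\top)$ is derivable from no premises; (BOT) $(\bot,\bot)$ is derivable from no premises; (WO) from $(A,X)$ derive $(A,Y)$ whenever $X\models Y$; (SI) from $(A,X)$ derive $(B,X)$ whenever $B\models A$; (AND) from $(A,X_1)$ and $(A,X_2)$ derive $(A,X_1\wedge X_2)$; (OR) from $(A_1,X)$ and $(A_2,X)$ derive $(A_1\vee A_2,X)$; (CT) from $(A,X)$ and $(A\wedge X,Y)$ derive $(A,Y)$. The logics: $OUT_1$ = {TOP, WO, SI, AND}; $OUT_2$ = $OUT_1$ + OR; $OUT_3$ = $OUT_1$ + CT; $OUT_4$ = $OUT_1$ + OR + CT; $OUT_k^+$ = $OUT_k$ + BOT. $G\vdash_{L}(B,Y)$ means there is a finite tree with root $(B,Y)$, each leaf an element of $G$ or an axiom of $L$, and each non-leaf node obtained from its children by a rule of $L$. $\mathbf{K}$ is the basic normal modal logic; $\mathbf{D}$ is the axiom $\square A\to\Diamond A$ and $\mathbf{F}$ is the axiom $\Diamond A\to\square A$; $\mathbf{KD}$, $\mathbf{K+F}$, $\mathbf{KD+F}$ are the corresponding normal extensions (characterized respectively by Kripke frames where every world has at least one successor, at most one successor, exactly one successor). For a normal modal logic $L$, $\Sigma\models_L\varphi$ means (local consequence): in every Kripke model based on a frame for $L$, every world satisfying all formulas of $\Sigma$ satisfies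 $\varphi$. *)

theory Defs
  imports Main
begin

datatype 'a fm =
    Atom 'a | Top | Bot | Neg "'a fm"
  | Con "'a fm" "'a fm" | Dis "'a fm" "'a fm" | Imp "'a fm" "'a fm"

primrec eval :: "('a \<Rightarrow> bool) \<Rightarrow> 'a fm \<Rightarrow> bool" where
  "eval v (Atom p) \<longleftrightarrow> v p"
| "eval v Top \<longleftrightarrow> True"
| "eval v Bot \<longleftrightarrow> False"
| "eval v (Neg A) \<longleftrightarrow> \<not> eval v A"
| "eval v (Con A B) \<longleftrightarrow> eval v A \<and> eval v B"
| "eval v (Dis A B) \<longleftrightarrow> eval v A \<or> eval v B"
| "eval v (Imp A B) \<longleftrightarrow> (eval v A \<longrightarrow> eval v B)"

definition cl_entails :: "'a fm \<Rightarrow> 'a fm \<Rightarrow> bool" where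
  "cl_entails A B \<longleftrightarrow> (\<forall>v. eval v A \<longrightarrow> eval v B)"

datatype rule = TOP | BOT | WO | SI | AND | OR | CT

inductive derives :: "rule set \<Rightarrow> ('a fm \<times> 'a fm) set \<Rightarrow> 'a fm \<times> 'a fm \<Rightarrow> bool"
  for L :: "rule set" and G :: "('a fm \<times> 'a fm) set" where
  leaf: "P \<in> G \<Longrightarrow> derives L G P"
| top: "TOP \<in> L \<Longrightarrow> derives L G (Top, Top)"
| bot: "BOT \<in> L \<Longrightarrow> derives L G (Bot, Bot)"
| wo: "WO \<in> L \<Longrightarrow> derives L G (A, X) \<Longrightarrow> cl_entails X Y \<Longrightarrow> derives L G (A, Y)"
| si: "SI \<in> L \<Longrightarrow> derives L G (A, X) \<Longrightarrow> cl_entails B A \<Longrightarrow> derives L G (B, X)"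
| conj: "AND \<in> L \<Longrightarrow> derives L G (A, X1) \<Longrightarrow> derives L G (A, X2) \<Longrightarrow>
    derives L G (A, Con X1 X2)"
| disj: "OR \<in> L \<Longrightarrow> derives L G (A1, X) \<Longrightarrow> derives L G (A2, X) \<Longrightarrow>
    derives L G (Dis A1 A2, X)"
| ct: "CT \<in> L \<Longrightarrow> derives L G (A, X) \<Longrightarrow> derives L G (Con A X, Y) \<Longrightarrow> derives L G (A, Y)"

definition OUT1 :: "rule set" where "OUT1 = {TOP, WO, SI, AND}"
definition OUT2 :: "rule set" where "OUT2 = OUT1 \<union> {OR}"
definition OUT3 :: "rule set" where "OUT3 = OUT1 \<union> {CT}"
definition OUT4 :: "rule set" where "OUT4 = OUT1 \<union> {OR, CT}"
definition OUT1p :: "rule set" where "OUT1p = OUT1 \<union> {BOT}"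
definition OUT2p :: "rule set" where "OUT2p = OUT2 \<union> {BOT}"
definition OUT3p :: "rule set" where "OUT3p = OUT3 \<union> {BOT}"
definition OUT4p :: "rule set" where "OUT4p = OUT4 \<union> {BOT}"

datatype 'a mfm =
    MAtom 'a | MTop | MBot | MNeg "'a mfm"
  | MCon "'a mfm" "'a mfm" | MDis "'a mfm" "'a mfm" | MImp "'a mfm" "'a mfm"
  | Box "'a mfm"

definition Dia :: "'a mfm \<Rightarrow> 'a mfm" where
  "Dia A = MNeg (Box (MNeg A))"

primrec emb :: "'a fm \<Rightarrow> 'a mfm" where
  "emb (Atom p) = MAtom p"
| "emb Top = MTop"
| "emb Bot = MBot"
| "emb (Neg A) = MNeg (emb A)"
| "emb (Con A B) = MCon (emb A) (emb B)"
| "emb (Dis A B) = MDis (emb A) (emb B)"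
| "emb (Imp A B) = MImp (emb A) (emb B)"

(* Boolean evaluation that treats boxed formulas as additional atoms; it is used to
   express "substitution instance of a propositional tautology". *)
primrec beval :: "('a mfm \<Rightarrow> bool) \<Rightarrow> 'a mfm \<Rightarrow> bool" where
  "beval v (MAtom p) \<longleftrightarrow> v (MAtom p)"
| "beval v MTop \<longleftrightarrow> True"
| "beval v MBot \<longleftrightarrow> False"
| "beval v (MNeg A) \<longleftrightarrow> \<not> beval v A"
| "beval v (MCon A B) \<longleftrightarrow> beval v A \<and> beval v B"
| "beval v (MDis A B) \<longleftrightarrow> beval v A \<or> beval v B"
| "beval v (MImp A B) \<longleftrightarrow> (beval v A \<longrightarrow> beval v B)"
| "beval v (Box A) \<longleftrightarrow> v (Box A)"

(* The axiom sets Ax used below are closed under substitution, so no separate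
   substitution rule is needed. *)
inductive_set normal_logic :: "'a mfm set \<Rightarrow> 'a mfm set" for Ax :: "'a mfm set" where
  taut: "(\<forall>v. beval v A) \<Longrightarrow> A \<in> normal_logic Ax"
| axK: "MImp (Box (MImp A B)) (MImp (Box A) (Box B)) \<in> normal_logic Ax"
| ax: "A \<in> Ax \<Longrightarrow> A \<in> normal_logic Ax"
| mp: "MImp A B \<in> normal_logic Ax \<Longrightarrow> A \<in> normal_logic Ax \<Longrightarrow> B \<in> normal_logic Ax"
| nec: "A \<in> normal_logic Ax \<Longrightarrow> Box A \<in> normal_logic Ax"

definition axD :: "'a mfm set" where "axD = {MImp (Box A) (Dia A) | A. True}"
definition axF :: "'a mfm set" where "axF = {MImp (Dia A) (Box A) | A. True}"

definition logicK :: "'a mfm set" where "logicK = normal_logic {}"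
definition logicKD :: "'a mfm set" where "logicKD = normal_logic axD"
definition logicKF :: "'a mfm set" where "logicKF = normal_logic axF"
definition logicKDF :: "'a mfm set" where "logicKDF = normal_logic (axD \<union> axF)"

definition is_frame :: "'w set \<Rightarrow> 'w rel \<Rightarrow> bool" where
  "is_frame W R \<longleftrightarrow> W \<noteq> {} \<and> R \<subseteq> W \<times> W"

primrec sat :: "'w rel \<Rightarrow> ('w \<Rightarrow> 'a \<Rightarrow> bool) \<Rightarrow> 'w \<Rightarrow> 'a mfm \<Rightarrow> bool" where
  "sat R V w (MAtom p) \<longleftrightarrow> V w p"
| "sat R V w MTop \<longleftrightarrow> True"
| "sat R V w MBot \<longleftrightarrow> False"
| "sat R V w (MNeg A) \<longleftrightarrow> \<not> sat R V w A"
| "sat R V w (MCon A B) \<longleftrightarrow> sat R V w A \<and> sat R V w B"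
| "sat R V w (MDis A B) \<longleftrightarrow> sat R V w A \<or> sat R V w B"
| "sat R V w (MImp A B) \<longleftrightarrow> (sat R V w A \<longrightarrow> sat R V w B)"
| "sat R V w (Box A) \<longleftrightarrow> (\<forall>u. (w, u) \<in> R \<longrightarrow> sat R V u A)"

definition frame_for :: "'a mfm set \<Rightarrow> 'w set \<Rightarrow> 'w rel \<Rightarrow> bool" where
  "frame_for L W R \<longleftrightarrow> is_frame W R \<and> (\<forall>A\<in>L. \<forall>V. \<forall>w\<in>W. sat R V w A)"

(* HOL cannot quantify over types inside a formula, so the type 'w from which the
   worlds are drawn is an explicit parameter; the set W of worlds ranges over all its
   nonempty subsets. On a small finite 'w this consequence relation can be too strong
   (there are too few frames), so 'w is meant to be instantiated to infinite types. *)
definition modal_entails ::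
  "'w itself \<Rightarrow> 'a mfm set \<Rightarrow> 'a mfm set \<Rightarrow> 'a mfm \<Rightarrow> bool" where
  "modal_entails T L S A \<longleftrightarrow>
    (\<forall>(W :: 'w set) R V. frame_for L W R \<longrightarrow>
      (\<forall>w\<in>W. (\<forall>B\<in>S. sat R V w B) \<longrightarrow> sat R V w A))"

definition G12 :: "('a fm \<times> 'a fm) set \<Rightarrow> 'a mfm set" where
  "G12 G = {MImp (Box (emb A)) (emb X) | A X. (A, X) \<in> G}"

definition G34 :: "('a fm \<times> 'a fm) set \<Rightarrow> 'a mfm set" where
  "G34 G = {MImp (Box (emb A)) (MCon (emb X) (Box (emb X))) | A X. (A, X) \<in> G}"

lemma sat_beval: "sat R V w A \<longleftrightarrow> beval (sat R V w) A"
  by (induction A) simp_all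

lemma normal_logic_sound:
  assumes "is_frame W R" and "\<And>A V w. A \<in> Ax \<Longrightarrow> w \<in> W \<Longrightarrow> sat R V w A"
    and "A \<in> normal_logic Ax" and "w \<in> W"
  shows "sat R V w A"
  using assms(3,4)
proof (induction arbitrary: w)
  case (taut A)
  then show ?case using sat_beval[of R V w A] by simp
next
  case (axK A B)
  then show ?case by simp
next
  case (ax A)
  then show ?case by (rule assms(2))
next
  case (mp A B)
  from mp.IH(1)[OF mp.prems] mp.IH(2)[OF mp.prems] show ?case by simp
next
  case (nec A)
  have "u \<in> W" if "(w, u) \<in> R" for u
    using assms(1) that by (auto simp: is_frame_def)
  then show ?case using nec.IH by simp
qed

lemma frame_for_normal_logic:
  "frame_for (normal_logic Ax) W R \<longleftrightarrow>
    is_frame W R \<and> (\<forall>A\<in>Ax. \<forall>V. \<forall>w\<in>W. sat R V w A)"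
proof
  assume "frame_for (normal_logic Ax) W R"
  then show "is_frame W R \<and> (\<forall>A\<in>Ax. \<forall>V. \<forall>w\<in>W. sat R V w A)"
    unfolding frame_for_def using normal_logic.ax by blast
next
  assume *: "is_frame W R \<and> (\<forall>A\<in>Ax. \<forall>V. \<forall>w\<in>W. sat R V w A)"
  show "frame_for (normal_logic Ax) W R"
    unfolding frame_for_def
  proof (intro conjI ballI allI)
    show "is_frame W R" using * ..
    fix A V w assume "A \<in> normal_logic Ax" "w \<in> W"
    with * show "sat R V w A" by (blast intro: normal_logic_sound[of W R Ax A w V])
  qed
qed

lemma valid_axD:
  "(\<forall>A\<in>(axD :: 'a mfm set). \<forall>V. \<forall>w\<in>W. sat R V w A) \<longleftrightarrow> (\<forall>w\<in>W. \<exists>u. (w, u) \<in> R)"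
    (is "?L \<longleftrightarrow> ?R")
proof
  assume ?L
  then have "\<forall>w\<in>W. sat R (\<lambda>_ _. True) w (MImp (Box MTop) (Dia MTop) :: 'a mfm)"
    unfolding axD_def by blast
  then show ?R by (simp add: Dia_def)
next
  assume R: ?R
  show ?L
  proof (intro ballI allI)
    fix A :: "'a mfm" and V w assume "A \<in> axD" "w \<in> W"
    moreover from R \<open>w \<in> W\<close> obtain u where "(w, u) \<in> R" by blast
    ultimately show "sat R V w A" by (auto simp: axD_def Dia_def)
  qed
qed

lemma valid_axF:
  "(\<forall>A\<in>(axF :: 'a mfm set). \<forall>V. \<forall>w\<in>W. sat R V w A) \<longleftrightarrow>
    (\<forall>w\<in>W. \<forall>u u'. (w, u) \<in> R \<longrightarrow> (w, u') \<in> R \<longrightarrow> u = u')"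
    (is "?L \<longleftrightarrow> ?R")
proof
  assume L: ?L
  show ?R
  proof (intro ballI allI impI)
    fix w u u' assume "w \<in> W" and R: "(w, u) \<in> R" "(w, u') \<in> R"
    then have "sat R (\<lambda>x _. x = u') w
        (MImp (Dia (MAtom undefined)) (Box (MAtom undefined)) :: 'a mfm)"
      using L unfolding axF_def by blast
    then show "u = u'" using R by (auto simp: Dia_def)
  qed
next
  assume R: ?R
  show ?L
  proof (intro ballI allI)
    fix A :: "'a mfm" and V w assume "A \<in> axF" and w: "w \<in> W"
    then obtain C where A: "A = MImp (Dia C) (Box C)" by (auto simp: axF_def)
    have "u = u'" if "(w, u) \<in> R" "(w, u') \<in> R" for u u'
      using R w that by blast
    then show "sat R V w A" unfolding A Dia_def sat.simps by blast
  qed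
qed

lemma frame_for_logicK: "frame_for logicK W R \<longleftrightarrow> is_frame W R"
  by (simp add: logicK_def frame_for_normal_logic)

lemma frame_for_logicKD:
  "frame_for (logicKD :: 'a mfm set) W R \<longleftrightarrow> is_frame W R \<and> (\<forall>w\<in>W. \<exists>u. (w, u) \<in> R)"
  unfolding logicKD_def frame_for_normal_logic
  by (rule conj_cong[OF refl valid_axD])

lemma frame_for_logicKF:
  "frame_for (logicKF :: 'a mfm set) W R \<longleftrightarrow>
    is_frame W R \<and> (\<forall>w\<in>W. \<forall>u u'. (w, u) \<in> R \<longrightarrow> (w, u') \<in> R \<longrightarrow> u = u')"
  unfolding logicKF_def frame_for_normal_logic
  by (rule conj_cong[OF refl valid_axF])

lemma frame_for_logicKDF:
  "frame_for (logicKDF :: 'a mfm set) W R \<longleftrightarrow> is_frame W R \<and> (\<forall>w\<in>W. \<exists>!u. (w, u) \<in> R)"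
proof -
  have "frame_for (logicKDF :: 'a mfm set) W R \<longleftrightarrow>
      frame_for (logicKD :: 'a mfm set) W R \<and> frame_for (logicKF :: 'a mfm set) W R"
    unfolding logicKDF_def logicKD_def logicKF_def frame_for_normal_logic by blast
  then show ?thesis
    unfolding frame_for_logicKD frame_for_logicKF by blast
qed

end

theory Submission
  imports Defs
begin

text \<open>
  At a world of a Kripke model, the translation of a pair only depends on the set \<open>S\<close> of
  valuations of the successors and on the set \<open>T\<close> of valuations at which the output is asserted:
  the world itself for the first translation, the world and its successors for the second one.
  Seriality is what validates BOT, functionality validates OR, and \<open>S \<subseteq> T\<close> validates CT.

  Conversely, let \<open>(B, Y)\<close> be underivable. Strengthen \<open>B\<close> to an input \<open>D\<close> for which \<open>Y\<close> is still
  underivable: with OR, \<open>D\<close> can be made to decide all inputs of \<open>G\<close>, and with CT it can be made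
  to entail all outputs it triggers. Finitely many models of \<open>D\<close> (a single one, if \<open>D\<close> decides
  the inputs) suffice to falsify every input not entailed by \<open>D\<close>; they are the successors of a
  root that satisfies the triggered outputs but not \<open>Y\<close>.
\<close>

section \<open>Soundness over sets of valuations\<close>

definition io_sat ::
  "('a \<Rightarrow> bool) set \<Rightarrow> ('a \<Rightarrow> bool) set \<Rightarrow> 'a fm \<times> 'a fm \<Rightarrow> bool" where
  "io_sat S T P \<longleftrightarrow> (\<forall>v\<in>S. eval v (fst P)) \<longrightarrow> (\<forall>v\<in>T. eval v (snd P))"

lemma derives_sound:
  assumes "derives L G P" and "\<And>Q. Q \<in> G \<Longrightarrow> io_sat S T Q"
    and "BOT \<in> L \<Longrightarrow> S \<noteq> {}" and "OR \<in> L \<Longrightarrow> \<forall>u\<in>S. \<forall>v\<in>S. u = v" and "CT \<in> L \<Longrightarrow> S \<subseteq> T"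
  shows "io_sat S T P"
  using assms(1)
proof induction
  case (leaf P)
  then show ?case by (rule assms(2))
next
  case bot
  then show ?case using assms(3) by (auto simp: io_sat_def)
next
  case (disj A1 X A2)
  \<comment> \<open>As \<open>S\<close> has at most one element, a disjunction true throughout
    \<open>S\<close> has a disjunct true throughout \<open>S\<close>.\<close>
  from assms(4)[OF disj.hyps(1)]
  have "(\<forall>v\<in>S. eval v (Dis A1 A2)) \<Longrightarrow> (\<forall>v\<in>S. eval v A1) \<or> (\<forall>v\<in>S. eval v A2)"
    by (metis eval.simps(6))
  then show ?case using disj.IH by (auto simp: io_sat_def)
next
  case (ct A X Y)
  \<comment> \<open>If \<open>A\<close> holds on \<open>S\<close>, the first premise makes
    \<open>X\<close> true on \<open>T\<close>, hence on \<open>S\<close>, so the second premise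
    applies.\<close>
  then show ?case using assms(5) by (auto simp: io_sat_def)
qed (auto simp: io_sat_def cl_entails_def)

section \<open>Combining outputs and strengthening inputs\<close>

text \<open>Iterated AND; the empty conjunction is \<open>Top\<close>, moved to the input
  \<open>B\<close> by SI. It gathers several outputs into one formula, so that a single use of CT or
  WO handles them all.\<close>

lemma derives_conjunction:
  assumes "{TOP, SI, AND} \<subseteq> L" and "finite Xs" and "\<And>X. X \<in> Xs \<Longrightarrow> derives L G (B, X)"
  obtains Z where "derives L G (B, Z)" and "\<forall>v. eval v Z \<longleftrightarrow> (\<forall>X\<in>Xs. eval v X)"
proof -
  have "\<exists>Z. derives L G (B, Z) \<and> (\<forall>v. eval v Z \<longleftrightarrow> (\<forall>X\<in>Xs. eval v X))"
    using assms(2,3)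
  proof (induction Xs)
    case empty
    have "derives L G (B, Top)"
      using assms(1) by (auto intro: derives.si[OF _ derives.top] simp: cl_entails_def)
    then show ?case by (intro exI[of _ Top]) simp
  next
    case (insert X Xs)
    then obtain Z where "derives L G (B, Z)" "\<forall>v. eval v Z \<longleftrightarrow> (\<forall>X\<in>Xs. eval v X)" by auto
    then show ?case
      using assms(1) insert.prems by (intro exI[of _ "Con X Z"]) (auto intro: derives.conj)
  qed
  then show thesis using that by blast
qed

text \<open>Each formula \<open>A\<close> of \<open>F\<close> is decided in turn: if adding
  \<open>A\<close> and adding \<open>Neg A\<close> to \<open>C\<close> both gave \<open>Y\<close>,
  then OR followed by SI would give \<open>Y\<close> from \<open>C\<close>.\<close>

lemma not_derives_decide:
  assumes "{SI, OR} \<subseteq> L" and "finite F" and "\<not> derives L G (B, Y)"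
  obtains C where "cl_entails C B" and "\<not> derives L G (C, Y)"
    and "\<And>A. A \<in> F \<Longrightarrow> cl_entails C A \<or> cl_entails C (Neg A)"
proof -
  have "\<exists>C. cl_entails C B \<and> \<not> derives L G (C, Y) \<and>
      (\<forall>A\<in>F. cl_entails C A \<or> cl_entails C (Neg A))"
    using assms(2)
  proof (induction F)
    case empty
    then show ?case using assms(3) by (auto simp: cl_entails_def)
  next
    case (insert A F)
    then obtain C where C: "cl_entails C B" "\<not> derives L G (C, Y)"
      "\<forall>A\<in>F. cl_entails C A \<or> cl_entails C (Neg A)" by blast
    have "cl_entails C (Dis (Con C A) (Con C (Neg A)))" by (auto simp: cl_entails_def)
    with C(2) have "\<not> derives L G (Con C A, Y) \<or> \<not> derives L G (Con C (Neg A), Y)"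
      using assms(1) by (meson derives.disj derives.si insert_subset)
    then obtain E where "E \<in> {A, Neg A}" "\<not> derives L G (Con C E, Y)" by blast
    with C(1,3) show ?case
      by (intro exI[of _ "Con C E"]) (auto simp: cl_entails_def)
  qed
  then show thesis using that by blast
qed

text \<open>\<open>C\<close> is conjoined with all outputs of \<open>G\<close> derivable from it. CT
  cancels this conjunct, so the stronger input derives nothing new and one round already reaches
  closure.\<close>

lemma not_derives_saturate:
  assumes "{TOP, SI, AND, CT} \<subseteq> L" and "finite G" and "\<not> derives L G (C, Y)"
  obtains D where "cl_entails D C" and "\<not> derives L G (D, Y)"
    and "\<And>A X. (A, X) \<in> G \<Longrightarrow> cl_entails D A \<Longrightarrow> cl_entails D X"
proof -
  let ?Xs = "{X \<in> snd ` G. derives L G (C, X)}"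
  have "finite ?Xs" using assms(2) by simp
  then obtain Z where Z: "derives L G (C, Z)" "\<forall>v. eval v Z \<longleftrightarrow> (\<forall>X\<in>?Xs. eval v X)"
    using assms(1) by (auto intro: derives_conjunction[of L ?Xs G C])
  have cut: "derives L G (C, X)" if "derives L G (Con C Z, X)" for X
    using assms(1) Z(1) that by (auto intro: derives.ct)
  show thesis
  proof
    show "cl_entails (Con C Z) C" by (simp add: cl_entails_def)
    show "\<not> derives L G (Con C Z, Y)" using cut assms(3) by blast
    fix A X assume "(A, X) \<in> G" "cl_entails (Con C Z) A"
    then have "derives L G (Con C Z, X)"
      using assms(1) by (auto intro: derives.si[OF _ derives.leaf])
    with \<open>(A, X) \<in> G\<close> have "X \<in> ?Xs" using cut by force
    then show "cl_entails (Con C Z) X" using Z(2) by (auto simp: cl_entails_def)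
  qed
qed

section \<open>Countermodels made of valuations\<close>

text \<open>One model of \<open>D\<close> is chosen for each formula of \<open>F\<close> that
  \<open>D\<close> does not entail.\<close>

lemma finite_refuting_valuations:
  assumes "finite F"
  obtains S where "finite S" and "\<And>v. v \<in> S \<Longrightarrow> eval v D"
    and "\<And>A. A \<in> F \<Longrightarrow> (\<forall>v\<in>S. eval v A) \<Longrightarrow> cl_entails D A"
proof -
  define s where "s A = (SOME v. eval v D \<and> \<not> eval v A)" for A
  have s: "eval (s A) D \<and> \<not> eval (s A) A" if "\<not> cl_entails D A" for A
    using that someI_ex[of "\<lambda>v. eval v D \<and> \<not> eval v A"] by (auto simp: s_def cl_entails_def)
  show thesis
  proof (rule that)
    show "finite (s ` {A \<in> F. \<not> cl_entails D A})" using assms by simp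
  qed (use s in auto)
qed

lemma derives_complete:
  assumes L: "{TOP, WO, SI, AND} \<subseteq> L" and "finite G" and "\<not> derives L G (B, Y)"
  obtains S w where "finite S" and "BOT \<in> L \<Longrightarrow> S \<noteq> {}"
    and "OR \<in> L \<Longrightarrow> \<forall>u\<in>S. \<forall>v\<in>S. u = v"
    and "\<And>P. P \<in> G \<Longrightarrow> io_sat S (if CT \<in> L then insert w S else {w}) P"
    and "\<not> io_sat S (if CT \<in> L then insert w S else {w}) (B, Y)"
proof -
  \<comment> \<open>\<open>Bot\<close> is included so that an empty \<open>S\<close> forces
    \<open>D\<close> to be inconsistent, which BOT excludes.\<close>
  let ?F = "insert Bot (fst ` G)"
  have "finite ?F" using assms(2) by simp
  obtain C where C: "cl_entails C B" "\<not> derives L G (C, Y)"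
    "OR \<in> L \<Longrightarrow> \<forall>A\<in>?F. cl_entails C A \<or> cl_entails C (Neg A)"
  proof (cases "OR \<in> L")
    case True
    then show thesis
      using L not_derives_decide[OF _ \<open>finite ?F\<close> assms(3)] that by (metis insert_subset)
  next
    case False
    then show thesis using that[of B] assms(3) by (auto simp: cl_entails_def)
  qed
  obtain D where D: "cl_entails D C" "\<not> derives L G (D, Y)"
    "CT \<in> L \<Longrightarrow> \<forall>(A, X)\<in>G. cl_entails D A \<longrightarrow> cl_entails D X"
  proof (cases "CT \<in> L")
    case True
    with L have "{TOP, SI, AND, CT} \<subseteq> L" by simp
    then show thesis
      using not_derives_saturate[OF _ assms(2) C(2)] that by (metis (no_types, lifting) case_prodI2)
  next
    case False
    then show thesis using that[of C] C(2) by (auto simp: cl_entails_def)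
  qed
  obtain S where S: "finite S" "\<And>v. v \<in> S \<Longrightarrow> eval v D"
    "\<And>A. A \<in> ?F \<Longrightarrow> (\<forall>v\<in>S. eval v A) \<Longrightarrow> cl_entails D A"
    "OR \<in> L \<Longrightarrow> \<forall>u\<in>S. \<forall>v\<in>S. u = v"
  proof (cases "OR \<in> L")
    case True
    then have dec: "cl_entails D A \<or> cl_entails D (Neg A)" if "A \<in> ?F" for A
      using C(3) D(1) that unfolding cl_entails_def by blast
    show thesis
    \<comment> \<open>Any single model of \<open>D\<close> refutes every formula of
      \<open>?F\<close> that \<open>D\<close> does not entail, since \<open>D\<close> entails its
      negation. An inconsistent \<open>D\<close> entails everything, so the empty set works.\<close>
    proof (cases "\<exists>v. eval v D")
      case True
      then obtain v where "eval v D" ..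
      with dec show thesis by (intro that[of "{v}"]) (auto simp: cl_entails_def)
    next
      case False
      then show thesis by (intro that[of "{}"]) (auto simp: cl_entails_def)
    qed
  next
    case False
    then show thesis using finite_refuting_valuations[OF \<open>finite ?F\<close>] that by metis
  qed
  \<comment> \<open>The triggered outputs are derivable from \<open>D\<close>, hence so is their
    conjunction \<open>Z\<close>. By WO, \<open>Z\<close> cannot entail \<open>Y\<close>; this
    yields the root valuation \<open>w\<close>.\<close>
  let ?Xs = "snd ` {P \<in> G. cl_entails D (fst P)}"
  have "{TOP, SI, AND} \<subseteq> L" "finite ?Xs" using L assms(2) by auto
  moreover have "derives L G (D, X)" if "X \<in> ?Xs" for X
    using L that by (auto intro: derives.si[OF _ derives.leaf])
  ultimately obtain Z where Z: "derives L G (D, Z)" "\<forall>v. eval v Z \<longleftrightarrow> (\<forall>X\<in>?Xs. eval v X)"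
    by (rule derives_conjunction)
  have "\<not> cl_entails Z Y" using L Z(1) D(2) by (auto intro: derives.wo)
  then obtain w where w: "\<forall>X\<in>?Xs. eval w X" "\<not> eval w Y"
    using Z(2) by (auto simp: cl_entails_def)
  show thesis
  proof (rule that[of S w])
    show "finite S" "OR \<in> L \<Longrightarrow> \<forall>u\<in>S. \<forall>v\<in>S. u = v" by (fact S)+
    show "S \<noteq> {}" if "BOT \<in> L"
    proof
      assume "S = {}"
      then have "cl_entails D Bot" using S(3)[of Bot] by simp
      moreover have "derives L G (Bot, Y)"
        using L that by (auto intro: derives.wo[OF _ derives.bot] simp: cl_entails_def)
      ultimately show False using L D(2) by (auto intro: derives.si)
    qed
    show "io_sat S (if CT \<in> L then insert w S else {w}) P" if "P \<in> G" for P
      unfolding io_sat_def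
    proof
      assume "\<forall>v\<in>S. eval v (fst P)"
      with that have *: "cl_entails D (fst P)" by (intro S(3)) auto
      \<comment> \<open>Under CT, saturation makes the triggered output true in every model of
        \<open>D\<close>, in particular on \<open>S\<close>.\<close>
      moreover have "eval v (snd P)" if "CT \<in> L" "v \<in> S" for v
        using D(3)[OF that(1)] * \<open>P \<in> G\<close> S(2)[OF that(2)]
        by (auto simp: cl_entails_def split_beta)
      ultimately show "\<forall>v\<in>if CT \<in> L then insert w S else {w}. eval v (snd P)"
        using w(1) \<open>P \<in> G\<close> by (cases P) auto
    qed
    show "\<not> io_sat S (if CT \<in> L then insert w S else {w}) (B, Y)"
      using w(2) S(2) C(1) D(1) by (auto simp: io_sat_def cl_entails_def)
  qed
qed

section \<open>From valuations to Kripke models\<close>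

text \<open>The successors of the root are made reflexive, so that seriality and functionality of the
  frame only depend on the root.\<close>

lemma rooted_model:
  fixes S :: "('a \<Rightarrow> bool) set"
  assumes "infinite (UNIV :: 'w set)" and "finite S"
  obtains W :: "'w set" and R V r where "is_frame W R" and "r \<in> W" and "V r = w"
    and "V ` R `` {r} = S" and "S \<noteq> {} \<Longrightarrow> \<forall>x\<in>W. \<exists>y. (x, y) \<in> R"
    and "\<forall>u\<in>S. \<forall>v\<in>S. u = v \<Longrightarrow> \<forall>x\<in>W. \<forall>y y'. (x, y) \<in> R \<longrightarrow> (x, y') \<in> R \<longrightarrow> y = y'"
proof -
  fix r :: 'w
  \<comment> \<open>An infinite type leaves room for one successor per valuation in
    \<open>S\<close>, all distinct from the root.\<close>
  have "infinite (UNIV - {r})" using assms(1) by simp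
  then obtain N where N: "finite N" "card N = card S" "N \<subseteq> UNIV - {r}"
    using infinite_arbitrarily_large by blast
  then obtain g where g: "bij_betw g N S"
    using assms(2) finite_same_card_bij by blast
  let ?R = "{r} \<times> N \<union> Id_on N" and ?V = "g(r := w)"
  have "?R `` {r} = N" using N(3) by auto
  moreover have "?V ` N = S" using g N(3) by (auto simp: bij_betw_def)
  ultimately have img: "?V ` ?R `` {r} = S" by simp
  show thesis
  proof (rule that[of "insert r N" ?R r ?V])
    show "?V ` ?R `` {r} = S" by (fact img)
    show "\<forall>x\<in>insert r N. \<exists>y. (x, y) \<in> ?R" if "S \<noteq> {}"
      using that g by (auto simp: bij_betw_def)
    show "\<forall>x\<in>insert r N. \<forall>y y'. (x, y) \<in> ?R \<longrightarrow> (x, y') \<in> ?R \<longrightarrow> y = y'"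
      if "\<forall>u\<in>S. \<forall>v\<in>S. u = v"
    proof -
      \<comment> \<open>Injectivity of \<open>g\<close> turns at most one valuation into at most one
        successor.\<close>
      have "y = y'" if "y \<in> N" "y' \<in> N" for y y'
        using that g \<open>\<forall>u\<in>S. \<forall>v\<in>S. u = v\<close> by (auto simp: bij_betw_def inj_on_def)
      then show ?thesis by blast
    qed
  qed (auto simp: is_frame_def)
qed

lemma sat_emb: "sat R V w (emb A) \<longleftrightarrow> eval (V w) A"
  by (induction A) simp_all

lemma sat_box_imp:
  "sat R V w (MImp (Box (emb A)) (emb X)) \<longleftrightarrow> io_sat (V ` R `` {w}) {V w} (A, X)"
  by (auto simp: io_sat_def sat_emb)

lemma sat_box_imp_box:
  "sat R V w (MImp (Box (emb A)) (MCon (emb X) (Box (emb X)))) \<longleftrightarrow>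
    io_sat (V ` R `` {w}) (insert (V w) (V ` R `` {w})) (A, X)"
  by (auto simp: io_sat_def sat_emb)

text \<open>Treats all eight logics at once: membership of BOT and OR in \<open>L\<close> fixes the
  frame class, and membership of CT fixes the translation \<open>t\<close>.\<close>

lemma derives_iff_modal_entails:
  fixes G :: "('a fm \<times> 'a fm) set" and M :: "'a mfm set" and t :: "'a fm \<Rightarrow> 'a fm \<Rightarrow> 'a mfm"
  assumes L: "{TOP, WO, SI, AND} \<subseteq> L" and "finite G" and "infinite (UNIV :: 'w set)"
    and frame: "\<And>(W :: 'w set) R. frame_for M W R \<longleftrightarrow> is_frame W R \<and>
      (BOT \<in> L \<longrightarrow> (\<forall>x\<in>W. \<exists>y. (x, y) \<in> R)) \<and>
      (OR \<in> L \<longrightarrow> (\<forall>x\<in>W. \<forall>y y'. (x, y) \<in> R \<longrightarrow> (x, y') \<in> R \<longrightarrow> y = y'))"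
    and t: "\<And>(R :: 'w rel) V w A X. sat R V w (t A X) \<longleftrightarrow>
      io_sat (V ` R `` {w}) (if CT \<in> L then insert (V w) (V ` R `` {w}) else {V w}) (A, X)"
  shows "derives L G (B, Y) \<longleftrightarrow>
    modal_entails TYPE('w) M {t A X | A X. (A, X) \<in> G} (t B Y)"
proof
  assume d: "derives L G (B, Y)"
  show "modal_entails TYPE('w) M {t A X | A X. (A, X) \<in> G} (t B Y)"
    unfolding modal_entails_def
  proof (intro allI impI ballI)
    fix W :: "'w set" and R V w
    assume fr: "frame_for M W R" and w: "w \<in> W"
      and G: "\<forall>C\<in>{t A X | A X. (A, X) \<in> G}. sat R V w C"
    show "sat R V w (t B Y)"
      unfolding t
    proof (rule derives_sound[OF d])
      fix P assume "P \<in> G"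
      then have "sat R V w (t (fst P) (snd P))" using G by (cases P) auto
      then show "io_sat (V ` R `` {w})
          (if CT \<in> L then insert (V w) (V ` R `` {w}) else {V w}) P"
        unfolding t by simp
    next
      assume "BOT \<in> L"
      then show "V ` R `` {w} \<noteq> {}" using fr w unfolding frame by blast
    next
      assume "OR \<in> L"
      then show "\<forall>u\<in>V ` R `` {w}. \<forall>v\<in>V ` R `` {w}. u = v"
        using fr w unfolding frame by blast
    qed auto
  qed
next
  assume m: "modal_entails TYPE('w) M {t A X | A X. (A, X) \<in> G} (t B Y)"
  show "derives L G (B, Y)"
  proof (rule ccontr)
    assume "\<not> derives L G (B, Y)"
    from derives_complete[OF L assms(2) this] obtain S w where
      S: "finite S" "BOT \<in> L \<Longrightarrow> S \<noteq> {}" "OR \<in> L \<Longrightarrow> \<forall>u\<in>S. \<forall>v\<in>S. u = v"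
      and G: "\<And>P. P \<in> G \<Longrightarrow> io_sat S (if CT \<in> L then insert w S else {w}) P"
      and BY: "\<not> io_sat S (if CT \<in> L then insert w S else {w}) (B, Y)"
      by blast
    obtain W :: "'w set" and R V r where
      R: "is_frame W R" "r \<in> W" "V r = w" "V ` R `` {r} = S"
      "S \<noteq> {} \<Longrightarrow> \<forall>x\<in>W. \<exists>y. (x, y) \<in> R"
      "\<forall>u\<in>S. \<forall>v\<in>S. u = v \<Longrightarrow> \<forall>x\<in>W. \<forall>y y'. (x, y) \<in> R \<longrightarrow> (x, y') \<in> R \<longrightarrow> y = y'"
      using rooted_model[OF assms(3) S(1), of w thesis] by blast
    have "frame_for M W R"
      unfolding frame using R(1,5,6) S(2,3) by blast
    moreover have "\<forall>C\<in>{t A X | A X. (A, X) \<in> G}. sat R V r C"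
      using G by (auto simp: t R(3,4))
    ultimately have "sat R V r (t B Y)"
      using m R(2) unfolding modal_entails_def by blast
    then show False using BY unfolding t R(3,4) by contradiction
  qed
qed

theorem theorem5:
  fixes G :: "('a fm \<times> 'a fm) set" and B Y :: "'a fm"
  assumes "finite G"
    and "infinite (UNIV :: 'w set)"
  shows
    "((derives OUT1 G (B, Y) \<longleftrightarrow>
        modal_entails TYPE('w) logicK (G12 G) (MImp (Box (emb B)) (emb Y))) \<and>
      (derives OUT2 G (B, Y) \<longleftrightarrow>
        modal_entails TYPE('w) logicKF (G12 G) (MImp (Box (emb B)) (emb Y)))) \<and>
     ((derives OUT3 G (B, Y) \<longleftrightarrow>
        modal_entails TYPE('w) logicK (G34 G)
          (MImp (Box (emb B)) (MCon (emb Y) (Box (emb Y))))) \<and>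
      (derives OUT4 G (B, Y) \<longleftrightarrow>
        modal_entails TYPE('w) logicKF (G34 G)
          (MImp (Box (emb B)) (MCon (emb Y) (Box (emb Y)))))) \<and>
     ((derives OUT1p G (B, Y) \<longleftrightarrow>
        modal_entails TYPE('w) logicKD (G12 G) (MImp (Box (emb B)) (emb Y))) \<and>
      (derives OUT2p G (B, Y) \<longleftrightarrow>
        modal_entails TYPE('w) logicKDF (G12 G) (MImp (Box (emb B)) (emb Y)))) \<and>
     ((derives OUT3p G (B, Y) \<longleftrightarrow>
        modal_entails TYPE('w) logicKD (G34 G)
          (MImp (Box (emb B)) (MCon (emb Y) (Box (emb Y))))) \<and>
      (derives OUT4p G (B, Y) \<longleftrightarrow>
        modal_entails TYPE('w) logicKDF (G34 G)
          (MImp (Box (emb B)) (MCon (emb Y) (Box (emb Y))))))"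
proof -
  note defs = OUT1_def OUT2_def OUT3_def OUT4_def OUT1p_def OUT2p_def OUT3p_def OUT4p_def
  note frames = frame_for_logicK frame_for_logicKF frame_for_logicKD frame_for_logicKDF
  note iff = derives_iff_modal_entails[OF _ assms]
  note iff12 = iff[where t = "\<lambda>A X. MImp (Box (emb A)) (emb X)"]
  note iff34 = iff[where t = "\<lambda>A X. MImp (Box (emb A)) (MCon (emb X) (Box (emb X)))"]
  show ?thesis
    unfolding G12_def G34_def
    \<comment> \<open>The shape of the translated pair selects \<open>iff12\<close> or
      \<open>iff34\<close>. For \<open>logicKDF\<close>, the unique successor must be split into
      existence and uniqueness.\<close>
    by (intro conjI iff12 iff34; (unfold frames sat_box_imp sat_box_imp_box)?; simp add: defs; blast?)
qed

end
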